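(* Let $n\ge 3$ be an integer and let $G$ be a graph cospectral with the double star $P_2(1,n)$. Then the set of non-isolated vertices of $G$ can be partitioned into four nonempty sets $A,B,C,D$ such that the induced subgraphs $G[A\cup B]$, $G[B\cup C]$ and $G[C\cup D]$ are all complete bipartite graphs.
   Context: All graphs are finite, simple and undirected. The spectrum of a graph is the multiset of eigenvalues of its adjacency matrix; two graphs are cospectral if they have the same spectrum. For integers $a,b\ge 0$, the double star $P_2(a,b)$ is the tree obtained from the stars $K_{1,a}$ and $K_{1,b}$ by adding an edge between their center vertices. For $S\subseteq V(G)$, $G[S]$ denotes the subgraph induced by $S$. *)

theory Defs
  imports
    "Graph_Theory.Graph_Theory"
    "Graph_Theory.Kuratowski"
    "Jordan_Normal_Form.Char_Poly"
    "HOL-Computational_Algebra.Polynomial"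
    "HOL-Combinatorics.List_Permutation"
    "HOL-Library.Disjoint_Sets"
begin

text \<open>
  A finite simple undirected graph is a member of the locale \<^locale>\<open>graph\<close>: a finite,
  loop-free, symmetric digraph without parallel arcs.
\<close>

definition adj_matrix :: "('a, 'b) pre_digraph \<Rightarrow> 'a list \<Rightarrow> complex mat" where
  "adj_matrix G vs = Matrix.mat (length vs) (length vs)
     (\<lambda>(i, j). if vs ! i \<rightarrow>\<^bsub>G\<^esub> vs ! j then 1 else 0)"

text \<open>
  The multiset of eigenvalues, counted with (algebraic) multiplicity. The enumeration of the
  vertices is irrelevant, see \<open>graph_spectrum_eq\<close> below. The matrix is taken over the complex
  numbers so that the multiset is complete by definition, not because the matrix is symmetric.
\<close>
definition graph_spectrum :: "('a, 'b) pre_digraph \<Rightarrow> complex multiset" where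
  "graph_spectrum G =
     proots (char_poly (adj_matrix G (SOME vs. distinct vs \<and> set vs = verts G)))"

definition cospectral :: "('a, 'b) pre_digraph \<Rightarrow> ('c, 'd) pre_digraph \<Rightarrow> bool" where
  "cospectral G H \<longleftrightarrow> graph_spectrum G = graph_spectrum H"

text \<open>The star $K_{1,k}$ with center \<open>0\<close>.\<close>
definition star_graph :: "nat \<Rightarrow> nat pair_pre_digraph" where
  "star_graph k = \<lparr> pverts = {0..k}, parcs = {0} \<times> {1..k} \<union> {1..k} \<times> {0} \<rparr>"

text \<open>The double star $P_2(a,b)$, on the disjoint union of the two stars.\<close>
definition double_star :: "nat \<Rightarrow> nat \<Rightarrow> (nat + nat) pair_pre_digraph" where
  "double_star a b =
     \<lparr> pverts = pverts (star_graph a) <+> pverts (star_graph b),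
       parcs = map_prod Inl Inl ` parcs (star_graph a) \<union> map_prod Inr Inr ` parcs (star_graph b)
         \<union> {(Inl 0, Inr 0), (Inr 0, Inl 0)} \<rparr>"

definition non_isolated :: "('a, 'b) pre_digraph \<Rightarrow> 'a set" where
  "non_isolated G = {v \<in> verts G. \<exists>u \<in> verts G. v \<rightarrow>\<^bsub>G\<^esub> u}"

text \<open>
  \<open>H\<close> is complete bipartite with the given colour classes \<open>X\<close> and \<open>Y\<close>. The library's
  \<^const>\<open>complete_bipartite_digraph\<close> leaves the classes existentially quantified and
  also admits empty ones; for the relation between the two see
  \<open>complete_bipartite_digraph_iff_parts\<close>.
\<close>
definition complete_bipartite_parts :: "'a set \<Rightarrow> 'a set \<Rightarrow> ('a, 'b) pre_digraph \<Rightarrow> bool" where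
  "complete_bipartite_parts X Y H \<longleftrightarrow> graph H \<and> X \<noteq> {} \<and> Y \<noteq> {} \<and>
     verts H = X \<union> Y \<and> X \<inter> Y = {} \<and> arcs_ends H = X \<times> Y \<union> Y \<times> X"

lemma complete_bipartite_digraph_iff_parts:
  assumes "m > 0" "n > 0"
  shows "complete_bipartite_digraph m n H \<longleftrightarrow>
    (\<exists>X Y. complete_bipartite_parts X Y H \<and> card X = m \<and> card Y = n)"
  using assms unfolding complete_bipartite_digraph_def complete_bipartite_parts_def
  by (metis card.empty less_numeral_extra(3))

lemma star_graph_complete_bipartite:
  "complete_bipartite_digraph 1 k (with_proj (star_graph k))"
  unfolding complete_bipartite_digraph_pair_def star_graph_def
  by (intro conjI exI[of _ "{0::nat}"] exI[of _ "{1..k}"]) auto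

lemma pair_graph_double_star: "pair_graph (double_star a b)"
proof
  have "finite (parcs (star_graph k))" for k
    by (simp add: star_graph_def)
  then show "finite (parcs (double_star a b))"
    by (simp add: double_star_def)
  show "finite (pverts (double_star a b))"
    by (simp add: double_star_def star_graph_def)
  show "symmetric (with_proj (double_star a b))"
    unfolding symmetric_def with_proj_simps
    by (rule symI) (auto simp: double_star_def star_graph_def)
qed (auto simp: double_star_def star_graph_def)

lemma char_poly_adj_matrix_eq:
  assumes "distinct vs" "distinct ws" "set vs = set ws"
  shows "char_poly (adj_matrix G vs) = char_poly (adj_matrix G ws)"
proof -
  define n where "n = length ws"
  have "mset vs = mset ws"
    using assms by (simp add: set_eq_iff_mset_eq_distinct)
  then obtain p where p: "p permutes {..<n}" and vs: "permute_list p ws = vs"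
    unfolding n_def by (rule mset_eq_permutation)
  have p': "p permutes {0..<n}"
    using p by (simp add: atLeast0LessThan)
  have len: "length vs = n"
    using vs by (auto simp: n_def)
  have nth: "vs ! i = ws ! p i" if "i < n" for i
    using that p vs by (auto simp: n_def permute_list_nth)
  have pl: "p i < n" if "i < n" for i
    using that p by (metis lessThan_iff permutes_in_image)
  have inj: "p i = p j \<longleftrightarrow> i = j" for i j
    using p by (metis permutes_inj injD)
  define M where "M = char_poly_matrix (adj_matrix G ws)"
  define N where "N = Matrix.mat n n (\<lambda>(i, j). M $$ (p i, j))"
  have M: "M \<in> carrier_mat n n"
    by (auto simp: M_def n_def adj_matrix_def)
  have N: "N \<in> carrier_mat n n"
    by (simp add: N_def)
  have "char_poly_matrix (adj_matrix G vs) =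
      transpose_mat (Matrix.mat n n (\<lambda>(i, j). transpose_mat N $$ (p i, j)))"
    by (rule eq_matI)
      (auto simp: char_poly_matrix_def N_def M_def adj_matrix_def len nth pl inj n_def[symmetric])
  also have "det \<dots> = signof p * det (transpose_mat N)"
    using N by (subst det_transpose[where n = n]) (auto intro!: det_permute_rows p')
  also have "\<dots> = signof p * (signof p * det M)"
    unfolding det_transpose[OF N] unfolding N_def det_permute_rows[OF M p'] ..
  also have "\<dots> = det M"
    by (simp add: sign_def)
  finally show ?thesis
    by (simp add: char_poly_def M_def)
qed

lemma graph_spectrum_eq:
  assumes "distinct vs" "set vs = verts G"
  shows "graph_spectrum G = proots (char_poly (adj_matrix G vs))"
proof -
  let ?P = "\<lambda>ws. distinct ws \<and> set ws = verts G"
  have "?P (SOME ws. ?P ws)"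
    by (rule someI[of ?P vs]) (use assms in simp)
  then have "char_poly (adj_matrix G (SOME ws. ?P ws)) = char_poly (adj_matrix G vs)"
    using assms by (intro char_poly_adj_matrix_eq) simp_all
  then show ?thesis
    by (simp add: graph_spectrum_def)
qed

lemma set_mset_graph_spectrum:
  assumes "distinct vs" "set vs = verts G"
  shows "set_mset (graph_spectrum G) = {x. eigenvalue (adj_matrix G vs) x}"
proof -
  have A: "adj_matrix G vs \<in> carrier_mat (length vs) (length vs)"
    by (simp add: adj_matrix_def)
  have "char_poly (adj_matrix G vs) \<noteq> 0"
    using degree_monic_char_poly[OF A] by auto
  then show ?thesis
    by (simp add: graph_spectrum_eq[OF assms] eigenvalue_root_char_poly[OF A])
qed

end

(* Equal spectra mean equal numbers of closed walks of every length. The double star has no odd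
   closed walks, so G is bipartite; let N be its biadjacency matrix. The traces of N N^T, (N N^T)^2,
   (N N^T)^3 equal those of the double star, so the elementary symmetric functions of the eigenvalues
   of N N^T are e1 = n + 2 (the number of edges), e2 = n and e3 = 0. By Cauchy-Binet e3 is the sum of
   the squared 3x3 minors of N, hence N is a 0/1 matrix of rank 2: up to repeated rows and columns
   the non-isolated part of G is 2 K_2, P_4 or P_5. Comparing e1 with e2, the sum of the squared
   2x2 minors, leaves only the blow-ups of P_4. *)
theory Submission
  imports Defs "Jordan_Normal_Form.Schur_Decomposition"
begin

text \<open>A 0/1 matrix of rank 2 can have three kinds of nonzero columns, with patterns 10, 01 and
  11 in two independent rows. If all three occur, the relation 11 = 10 + 01 holds in every row, so
  no row has a 1 in both of the first two kinds, and the nonzero rows are of only two kinds. Hence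
  one side of G always falls into two classes, but which side is not known in advance; the tools are
  therefore stated so that the sides can be exchanged. Once a side has two classes, e1 and e2 are
  polynomials in five class sizes, and the decisive relation is e2 = e1 - 2: for a blow-up of 2 K_2
  whose components have x and y edges it would say (x - 1)(y - 1) = -1, while a blow-up of P_5
  always has e2 > e1 - 2.\<close>

section \<open>Power sums of eigenvalues as matrix traces\<close>

definition mat_trace :: "'a :: comm_ring_1 mat \<Rightarrow> 'a" where
  "mat_trace A = (\<Sum>i<dim_row A. A $$ (i, i))"

lemma index_mat_mult_sum:
  assumes "A \<in> carrier_mat n m" "B \<in> carrier_mat m l" "i < n" "j < l"
  shows "(A * B) $$ (i, j) = (\<Sum>k<m. A $$ (i, k) * B $$ (k, j))"
  using assms by (auto simp: scalar_prod_def atLeast0LessThan intro!: sum.cong)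

lemma mat_trace_mult_commute:
  assumes "A \<in> carrier_mat n m" "B \<in> carrier_mat m n"
  shows "mat_trace (A * B) = mat_trace (B * A)"
proof -
  have "mat_trace (A * B) = (\<Sum>i<n. \<Sum>k<m. A $$ (i, k) * B $$ (k, i))"
    using assms by (auto simp: mat_trace_def index_mat_mult_sum[OF assms] simp del: index_mult_mat(1))
  also have "\<dots> = (\<Sum>k<m. \<Sum>i<n. B $$ (k, i) * A $$ (i, k))"
    by (subst sum.swap) (simp add: mult.commute)
  also have "\<dots> = mat_trace (B * A)"
    using assms by (auto simp: mat_trace_def index_mat_mult_sum[OF assms(2,1)] simp del: index_mult_mat(1))
  finally show ?thesis .
qed

lemma mat_trace_similar:
  assumes "similar_mat A B"
  shows "mat_trace A = mat_trace B"
proof -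
  obtain n P Q where c: "{A, B, P, Q} \<subseteq> carrier_mat n n"
    and QP: "Q * P = 1\<^sub>m n" and A: "A = P * B * Q"
    using similar_matD[OF assms] by blast
  have "mat_trace A = mat_trace (Q * (P * B))"
    unfolding A using c by (intro mat_trace_mult_commute[of _ n n]) auto
  also have "Q * (P * B) = (Q * P) * B"
    using c by (auto intro!: assoc_mult_mat[symmetric])
  finally show ?thesis
    using c left_mult_one_mat[of B n n] by (simp add: QP)
qed

lemma upper_triangular_pow:
  assumes B: "B \<in> carrier_mat n n" and tri: "upper_triangular (B :: 'a :: comm_ring_1 mat)"
  shows "upper_triangular (B ^\<^sub>m k) \<and> (\<forall>i<n. (B ^\<^sub>m k) $$ (i, i) = (B $$ (i, i)) ^ k)"
proof (induction k)
  case 0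
  then show ?case
    using B by auto
next
  case (Suc k)
  have Bk: "B ^\<^sub>m k \<in> carrier_mat n n"
    using B by auto
  have lo: "B $$ (i, j) = 0" "(B ^\<^sub>m k) $$ (i, j) = 0" if "j < i" "i < n" for i j
    using that tri Suc B Bk by (auto simp: upper_triangular_def)
  have ent: "(B ^\<^sub>m Suc k) $$ (i, j) = (\<Sum>l<n. (B ^\<^sub>m k) $$ (i, l) * B $$ (l, j))"
    if "i < n" "j < n" for i j
    using that by (simp add: index_mat_mult_sum[OF Bk B] del: index_mult_mat(1))
  \<comment> \<open>For \<open>l < i\<close> the left factor lies below the diagonal, for
    \<open>l > j\<close> the right one does. If \<open>j < i\<close> this covers every
    \<open>l\<close>; if \<open>j = i\<close> only \<open>l = i\<close> survives.\<close>
  have z: "(B ^\<^sub>m k) $$ (i, l) * B $$ (l, j) = 0" if "i < n" "l < n" "j < i \<or> j = i \<and> l \<noteq> i" for i j l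
    using that lo by (metis linorder_neqE_nat mult_zero_left mult_zero_right order.strict_trans)
  have "(B ^\<^sub>m Suc k) $$ (i, i) = B $$ (i, i) ^ Suc k" if i: "i < n" for i
  proof -
    have "(B ^\<^sub>m Suc k) $$ (i, i) = (\<Sum>l<n. if l = i then (B ^\<^sub>m k) $$ (i, i) * B $$ (i, i) else 0)"
      unfolding ent[OF i i] using i z by (intro sum.cong) auto
    then show ?thesis
      using i Suc by (simp add: mult.commute)
  qed
  moreover have "upper_triangular (B ^\<^sub>m Suc k)"
  proof (rule upper_triangularI)
    fix i j
    assume j: "j < i" and i: "i < dim_row (B ^\<^sub>m Suc k)"
    then have "i < n"
      using B by simp
    then show "(B ^\<^sub>m Suc k) $$ (i, j) = 0"
      using j by (subst ent) (auto intro!: sum.neutral z)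
  qed
  ultimately show ?case
    by blast
qed

text \<open>Schur triangularisation gives a similar upper triangular matrix with the roots of the
  characteristic polynomial on its diagonal. Powers preserve similarity and triangularity, so the
  trace of a power can be read off that diagonal.\<close>

lemma sum_proots_char_poly_pow:
  fixes A :: "complex mat"
  assumes A: "A \<in> carrier_mat n n"
  shows "(\<Sum>x\<in>#proots (char_poly A). x ^ k) = mat_trace (A ^\<^sub>m k)"
proof -
  obtain es where es: "char_poly A = (\<Prod>e\<leftarrow>es. [:- e, 1:])"
    using char_poly_factorized[OF A] by blast
  obtain B P Q where sd: "schur_decomposition A es = (B, P, Q)"
    by (cases "schur_decomposition A es") auto
  have wit: "similar_mat_wit A B P Q" and tri: "upper_triangular B" and diag: "diag_mat B = es"
    using schur_decomposition[OF A es sd] by blast+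
  have B: "B \<in> carrier_mat n n"
    using similar_mat_witD2(5)[OF A wit] by simp
  have "proots (\<Prod>e\<leftarrow>xs. [:- e, 1:]) = mset xs" for xs :: "complex list"
  proof (induction xs)
    case (Cons x xs)
    have "(\<Prod>e\<leftarrow>xs. [:- e, 1:]) \<noteq> 0"
      by (auto simp: prod_list_zero_iff)
    then have "proots ([:- x, 1:] * (\<Prod>e\<leftarrow>xs. [:- e, 1:])) = add_mset x (mset xs)"
      by (subst proots_mult) (auto simp: Cons simp del: mult_pCons_left)
    then show ?case
      by simp
  qed simp
  then have "(\<Sum>x\<in>#proots (char_poly A). x ^ k) = (\<Sum>x\<leftarrow>diag_mat B. x ^ k)"
    by (simp add: es diag sum_mset_sum_list flip: mset_map)
  also have "\<dots> = (\<Sum>i<n. B $$ (i, i) ^ k)"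
    using B by (simp add: diag_mat_def comp_def interv_sum_list_conv_sum_set_nat atLeast0LessThan)
  also have "\<dots> = mat_trace (B ^\<^sub>m k)"
    using B upper_triangular_pow[OF B tri] by (simp add: mat_trace_def)
  also have "\<dots> = mat_trace (A ^\<^sub>m k)"
  proof (rule mat_trace_similar[symmetric])
    show "similar_mat (A ^\<^sub>m k) (B ^\<^sub>m k)"
      using similar_mat_wit_pow[OF wit, of k] by (auto simp: similar_mat_def)
  qed
  finally show ?thesis .
qed

section \<open>Closed walks and the spectrum\<close>

text \<open>The last step is split off to match the recursion
  \<open>A ^\<^sub>m Suc k = A ^\<^sub>m k * A\<close>.\<close>

primrec walks :: "'a set \<Rightarrow> ('a \<Rightarrow> 'a \<Rightarrow> bool) \<Rightarrow> nat \<Rightarrow> 'a \<Rightarrow> 'a \<Rightarrow> nat" where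
  "walks V E 0 u v = of_bool (u = v)"
| "walks V E (Suc k) u v = (\<Sum>w\<in>V. walks V E k u w * of_bool (E w v))"

definition closed_walks :: "'a set \<Rightarrow> ('a \<Rightarrow> 'a \<Rightarrow> bool) \<Rightarrow> nat \<Rightarrow> nat" where
  "closed_walks V E k = (\<Sum>v\<in>V. walks V E k v v)"

lemma adj_matrix_pow:
  assumes vs: "distinct vs" "set vs = verts G" and "i < length vs" "j < length vs"
  shows "(adj_matrix G vs ^\<^sub>m k) $$ (i, j) =
    of_nat (walks (verts G) (\<lambda>u v. u \<rightarrow>\<^bsub>G\<^esub> v) k (vs ! i) (vs ! j))"
  using assms(3,4)
proof (induction k arbitrary: j)
  case 0
  then show ?case
    using vs by (simp add: adj_matrix_def nth_eq_iff_index_eq)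
next
  case (Suc k)
  let ?A = "adj_matrix G vs" and ?n = "length vs"
  have A: "?A \<in> carrier_mat ?n ?n"
    by (simp add: adj_matrix_def)
  have Ak: "?A ^\<^sub>m k \<in> carrier_mat ?n ?n"
    using A by auto
  have bij: "bij_betw ((!) vs) {..<?n} (verts G)"
    using vs by (intro bij_betw_nth) auto
  have "(?A ^\<^sub>m Suc k) $$ (i, j) = (\<Sum>l<?n. (?A ^\<^sub>m k) $$ (i, l) * ?A $$ (l, j))"
    using Suc.prems by (simp add: index_mat_mult_sum[OF Ak A] del: index_mult_mat(1))
  also have "\<dots> = (\<Sum>l<?n. of_nat (walks (verts G) (\<lambda>u v. u \<rightarrow>\<^bsub>G\<^esub> v) k (vs ! i) (vs ! l))
      * of_bool (vs ! l \<rightarrow>\<^bsub>G\<^esub> vs ! j))"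
    using Suc by (intro sum.cong) (auto simp: adj_matrix_def)
  also have "\<dots> = (\<Sum>w\<in>verts G. of_nat (walks (verts G) (\<lambda>u v. u \<rightarrow>\<^bsub>G\<^esub> v) k (vs ! i) w)
      * of_bool (w \<rightarrow>\<^bsub>G\<^esub> vs ! j))"
    by (rule sum.reindex_bij_betw[OF bij])
  finally show ?case
    by simp
qed

lemma sum_graph_spectrum_pow:
  assumes "finite (verts G)"
  shows "(\<Sum>x\<in>#graph_spectrum G. x ^ k) = of_nat (closed_walks (verts G) (\<lambda>u v. u \<rightarrow>\<^bsub>G\<^esub> v) k)"
proof -
  obtain vs where vs: "distinct vs" "set vs = verts G"
    using finite_distinct_list[OF assms] by blast
  let ?A = "adj_matrix G vs" and ?n = "length vs"
  have A: "?A \<in> carrier_mat ?n ?n"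
    by (simp add: adj_matrix_def)
  have bij: "bij_betw ((!) vs) {..<?n} (verts G)"
    using vs by (intro bij_betw_nth) auto
  have "(\<Sum>x\<in>#graph_spectrum G. x ^ k) = mat_trace (?A ^\<^sub>m k)"
    by (simp only: graph_spectrum_eq[OF vs] sum_proots_char_poly_pow[OF A])
  also have "\<dots> = (\<Sum>i<?n. of_nat (walks (verts G) (\<lambda>u v. u \<rightarrow>\<^bsub>G\<^esub> v) k (vs ! i) (vs ! i)))"
    using A by (auto simp: mat_trace_def adj_matrix_pow[OF vs])
  also have "\<dots> = of_nat (closed_walks (verts G) (\<lambda>u v. u \<rightarrow>\<^bsub>G\<^esub> v) k)"
    unfolding closed_walks_def of_nat_sum by (rule sum.reindex_bij_betw[OF bij])
  finally show ?thesis .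
qed

text \<open>The only consequence of cospectrality that the proof uses. From here on complex numbers
  and matrices are replaced by integer counts.\<close>

lemma cospectral_closed_walks_eq:
  assumes "cospectral G H" "finite (verts G)" "finite (verts H)"
  shows "closed_walks (verts G) (\<lambda>u v. u \<rightarrow>\<^bsub>G\<^esub> v) k =
    closed_walks (verts H) (\<lambda>u v. u \<rightarrow>\<^bsub>H\<^esub> v) k"
  using sum_graph_spectrum_pow[OF assms(2), of k] sum_graph_spectrum_pow[OF assms(3), of k] assms(1)
  by (simp add: cospectral_def)

section \<open>Squared minors and Gram matrices\<close>

text \<open>Rows and columns are arbitrary elements, so colour classes need no enumeration. A
  repeated row or column gives 0, hence sums over ordered triples count the square of each genuine
  minor 36 times.\<close>

definition det3 :: "('a \<Rightarrow> 'b \<Rightarrow> int) \<Rightarrow> 'a \<Rightarrow> 'a \<Rightarrow> 'a \<Rightarrow> 'b \<Rightarrow> 'b \<Rightarrow> 'b \<Rightarrow> int" where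
  "det3 N i j k a b c = N i a * N j b * N k c - N i a * N j c * N k b - N i b * N j a * N k c
     + N i b * N j c * N k a + N i c * N j a * N k b - N i c * N j b * N k a"

text \<open>The entries of N N^T, with the columns of N indexed by \<open>Y\<close>.\<close>

definition gram :: "('a \<Rightarrow> 'b \<Rightarrow> int) \<Rightarrow> 'b set \<Rightarrow> 'a \<Rightarrow> 'a \<Rightarrow> int" where
  "gram N Y i j = (\<Sum>y\<in>Y. N i y * N j y)"

lemma gram_commute: "gram N Y i j = gram N Y j i"
  by (simp add: gram_def mult.commute)

lemma sum3_swap12: "(\<Sum>a\<in>Y. \<Sum>b\<in>Y. \<Sum>c\<in>Y. h b a c) = (\<Sum>a\<in>Y. \<Sum>b\<in>Y. \<Sum>c\<in>Y. h a b c)"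
  for h :: "'b \<Rightarrow> 'b \<Rightarrow> 'b \<Rightarrow> int"
  by (rule sum.swap)

lemma sum3_swap23: "(\<Sum>a\<in>Y. \<Sum>b\<in>Y. \<Sum>c\<in>Y. h a c b) = (\<Sum>a\<in>Y. \<Sum>b\<in>Y. \<Sum>c\<in>Y. h a b c)"
  for h :: "'b \<Rightarrow> 'b \<Rightarrow> 'b \<Rightarrow> int"
  by (intro sum.cong refl sum.swap)

lemma sum3_product:
  "(\<Sum>a\<in>Y. \<Sum>b\<in>Y. \<Sum>c\<in>Y. f a * g b * h c) = (\<Sum>a\<in>Y. f a) * (\<Sum>b\<in>Y. g b) * (\<Sum>c\<in>Y. h c)"
  for f g h :: "'b \<Rightarrow> int"
  by (simp only: flip: sum_distrib_left sum_distrib_right)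

text \<open>Cauchy-Binet for three fixed rows: the bracket is the determinant of their Gram matrix,
  and 6 counts the orderings of a column triple. By antisymmetry all six Leibniz terms contribute
  equally to the sum, so one factor of the square may be replaced by 6 times the diagonal product
  \<open>F\<close>.\<close>

lemma sum_det3_squared:
  fixes N :: "'a \<Rightarrow> 'b \<Rightarrow> int"
  shows "(\<Sum>a\<in>Y. \<Sum>b\<in>Y. \<Sum>c\<in>Y. (det3 N i j k a b c)\<^sup>2) =
    6 * (gram N Y i i * gram N Y j j * gram N Y k k - gram N Y i i * (gram N Y j k * gram N Y k j)
      - gram N Y j j * (gram N Y i k * gram N Y k i) - gram N Y k k * (gram N Y i j * gram N Y j i)
      + 2 * (gram N Y i j * gram N Y j k * gram N Y k i))"
proof -
  define S where "S h = (\<Sum>a\<in>Y. \<Sum>b\<in>Y. \<Sum>c\<in>Y. h a b c)" for h :: "'b \<Rightarrow> 'b \<Rightarrow> 'b \<Rightarrow> int"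
  define F where "F a b c = N i a * N j b * N k c" for a b c
  let ?D = "det3 N i j k"
  have s12: "S (\<lambda>a b c. h b a c) = S h" and s23: "S (\<lambda>a b c. h a c b) = S h" for h
    unfolding S_def by (rule sum3_swap12, rule sum3_swap23)
  have neg: "S (\<lambda>a b c. - f a b c) = - S f" for f
    by (simp add: S_def sum_negf)
  have cyc1: "S (\<lambda>a b c. h b c a) = S h" for h
    using s12[of "\<lambda>a b c. h a c b"] s23[of h] by simp
  have cyc2: "S (\<lambda>a b c. h c a b) = S h" for h
    using s23[of "\<lambda>a b c. h b a c"] s12[of h] by simp
  have s13: "S (\<lambda>a b c. h c b a) = S h" for h
    using s23[of "\<lambda>a b c. h b c a"] cyc1[of h] by simp
  have D: "?D a b c = F a b c - F a c b - F b a c + F b c a + F c a b - F c b a" for a b c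
    by (simp add: det3_def F_def)
  have perm: "S f = S h" if "\<And>a b c. f a b c = g a b c" "S g = S h" for f g h
  proof -
    have "f = g"
      by (intro ext) (rule that(1))
    then show ?thesis
      using that(2) by simp
  qed
  \<comment> \<open>Only one factor of the square is expanded; the other stays folded so that its
    antisymmetry can be used.\<close>
  have sq: "d\<^sup>2 = f1 * d - f2 * d - f3 * d + f4 * d + f5 * d - f6 * d"
    if "d = f1 - f2 - f3 + f4 + f5 - f6" for d f1 f2 f3 f4 f5 f6 :: int
    unfolding power2_eq_square by (subst (1) that) (simp only: left_diff_distrib distrib_right)
  have "(?D a b c)\<^sup>2 = F a b c * ?D a b c - F a c b * ?D a b c - F b a c * ?D a b c
      + F b c a * ?D a b c + F c a b * ?D a b c - F c b a * ?D a b c" for a b c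
    by (rule sq, rule D)
  then have "S (\<lambda>a b c. (?D a b c)\<^sup>2) = S (\<lambda>a b c. F a b c * ?D a b c) - S (\<lambda>a b c. F a c b * ?D a b c)
     - S (\<lambda>a b c. F b a c * ?D a b c) + S (\<lambda>a b c. F b c a * ?D a b c)
     + S (\<lambda>a b c. F c a b * ?D a b c) - S (\<lambda>a b c. F c b a * ?D a b c)"
    by (simp only: S_def sum.distrib sum_subtractf)
  also have "\<dots> = 6 * S (\<lambda>a b c. F a b c * ?D a b c)"
  proof -
    have "S (\<lambda>a b c. F a c b * ?D a b c) = S (\<lambda>a b c. - (F a b c * ?D a b c))"
      by (rule perm[OF _ s23]) (simp add: D algebra_simps)
    moreover have "S (\<lambda>a b c. F b a c * ?D a b c) = S (\<lambda>a b c. - (F a b c * ?D a b c))"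
      by (rule perm[OF _ s12]) (simp add: D algebra_simps)
    moreover have "S (\<lambda>a b c. F c b a * ?D a b c) = S (\<lambda>a b c. - (F a b c * ?D a b c))"
      by (rule perm[OF _ s13]) (simp add: D algebra_simps)
    moreover have "S (\<lambda>a b c. F b c a * ?D a b c) = S (\<lambda>a b c. F a b c * ?D a b c)"
      by (rule perm[OF _ cyc1]) (simp add: D algebra_simps)
    moreover have "S (\<lambda>a b c. F c a b * ?D a b c) = S (\<lambda>a b c. F a b c * ?D a b c)"
      by (rule perm[OF _ cyc2]) (simp add: D algebra_simps)
    ultimately show ?thesis
      by (simp only: neg)
  qed
  also have "S (\<lambda>a b c. F a b c * ?D a b c) =
      gram N Y i i * gram N Y j j * gram N Y k k
    - gram N Y i i * gram N Y j k * gram N Y k j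
    - gram N Y i j * gram N Y j i * gram N Y k k
    + gram N Y i k * gram N Y j i * gram N Y k j
    + gram N Y i j * gram N Y j k * gram N Y k i
    - gram N Y i k * gram N Y j j * gram N Y k i"
  proof -
    \<comment> \<open>Grouping by column lets \<open>sum3_product\<close> turn each term into a
      product of Gram entries.\<close>
    have "F a b c * ?D a b c =
        (N i a * N i a) * (N j b * N j b) * (N k c * N k c)
      - (N i a * N i a) * (N j b * N k b) * (N k c * N j c)
      - (N i a * N j a) * (N j b * N i b) * (N k c * N k c)
      + (N i a * N k a) * (N j b * N i b) * (N k c * N j c)
      + (N i a * N j a) * (N j b * N k b) * (N k c * N i c)
      - (N i a * N k a) * (N j b * N j b) * (N k c * N i c)" for a b c
      unfolding D F_def by (simp only: algebra_simps)
    then show ?thesis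
      by (simp only: S_def sum.distrib sum_subtractf sum3_product gram_def)
  qed
  finally show ?thesis
    unfolding S_def
    by (simp add: gram_commute[of N Y j i] gram_commute[of N Y k j] gram_commute[of N Y k i])
qed

text \<open>\<open>t1\<close>, \<open>t2\<close>, \<open>t3\<close> are the first three power sums
  of the eigenvalues of N N^T, so Newton's identities make the bracket 6 e3. The left side is 36 e3,
  since rows and columns are both ordered.\<close>

lemma sum_det3_squared_eq_traces:
  fixes N :: "'a \<Rightarrow> 'b \<Rightarrow> int"
  defines "t1 \<equiv> \<lambda>X Y. \<Sum>i\<in>X. gram N Y i i"
    and "t2 \<equiv> \<lambda>X Y. \<Sum>i\<in>X. \<Sum>j\<in>X. gram N Y i j * gram N Y j i"
    and "t3 \<equiv> \<lambda>X Y. \<Sum>i\<in>X. \<Sum>j\<in>X. \<Sum>k\<in>X. gram N Y i j * gram N Y j k * gram N Y k i"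
  shows "(\<Sum>i\<in>X. \<Sum>j\<in>X. \<Sum>k\<in>X. \<Sum>a\<in>Y. \<Sum>b\<in>Y. \<Sum>c\<in>Y. (det3 N i j k a b c)\<^sup>2) =
    6 * (t1 X Y ^ 3 - 3 * t1 X Y * t2 X Y + 2 * t3 X Y)"
proof -
  let ?g = "gram N Y"
  have s1: "(\<Sum>i\<in>X. \<Sum>j\<in>X. \<Sum>k\<in>X. ?g i i * ?g j j * ?g k k) = t1 X Y ^ 3"
    unfolding sum3_product by (simp add: t1_def power3_eq_cube)
  have s2: "(\<Sum>i\<in>X. \<Sum>j\<in>X. \<Sum>k\<in>X. ?g i i * (?g j k * ?g k j)) = t1 X Y * t2 X Y"
    by (simp only: t1_def t2_def flip: sum_distrib_left sum_distrib_right)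
  have s3: "(\<Sum>i\<in>X. \<Sum>j\<in>X. \<Sum>k\<in>X. ?g j j * (?g i k * ?g k i)) = t1 X Y * t2 X Y"
    using sum3_swap12[of "\<lambda>i j k. ?g i i * (?g j k * ?g k j)" X] s2 by simp
  have s4: "(\<Sum>i\<in>X. \<Sum>j\<in>X. \<Sum>k\<in>X. ?g k k * (?g i j * ?g j i)) = t1 X Y * t2 X Y"
    using sum3_swap23[of "\<lambda>i j k. ?g j j * (?g i k * ?g k i)" X] s3 by simp
  show ?thesis
    unfolding sum_det3_squared
    by (simp only: sum.distrib sum_subtractf s1 s2 s3 s4
        sum_distrib_left[where r = "6 :: int", symmetric]
        sum_distrib_left[where r = "2 :: int", symmetric])
      (simp add: t3_def algebra_simps)
qed

text \<open>By the previous identity, \<open>e3\<close> says that a sum of squares over all triples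
  vanishes.\<close>

lemma det3_eq_0:
  fixes N :: "'a \<Rightarrow> 'b \<Rightarrow> int"
  assumes fin: "finite X" "finite Y"
    and t: "(\<Sum>i\<in>X. gram N Y i i) = t1"
      "(\<Sum>i\<in>X. \<Sum>j\<in>X. gram N Y i j * gram N Y j i) = t2"
      "(\<Sum>i\<in>X. \<Sum>j\<in>X. \<Sum>k\<in>X. gram N Y i j * gram N Y j k * gram N Y k i) = t3"
    and e3: "t1 ^ 3 - 3 * t1 * t2 + 2 * t3 = 0"
    and mem: "i \<in> X" "j \<in> X" "k \<in> X" "a \<in> Y" "b \<in> Y" "c \<in> Y"
  shows "det3 N i j k a b c = 0"
proof -
  have "(\<Sum>i\<in>X. \<Sum>j\<in>X. \<Sum>k\<in>X. \<Sum>a\<in>Y. \<Sum>b\<in>Y. \<Sum>c\<in>Y. (det3 N i j k a b c)\<^sup>2) = 0"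
    unfolding sum_det3_squared_eq_traces t e3 by simp
  then show ?thesis
    using mem by (simp add: sum_nonneg_eq_0_iff sum_nonneg fin)
qed

text \<open>Expanded over \<open>i\<close>, \<open>j\<close>, \<open>a\<close>, \<open>b\<close>,
  both sides of the hypothesis contain the factor \<open>N i a * N j b\<close>; the other factor is
  the same product on the left and \<open>N i b * N j a\<close> on the right. If all minors
  vanished, the sums would agree termwise.\<close>

lemma exists_nonzero_minor2:
  fixes N :: "'a \<Rightarrow> 'b \<Rightarrow> int"
  assumes "(\<Sum>i\<in>X. gram N Y i i)\<^sup>2 \<noteq> (\<Sum>i\<in>X. \<Sum>j\<in>X. gram N Y i j * gram N Y j i)"
  obtains i j a b where "i \<in> X" "j \<in> X" "a \<in> Y" "b \<in> Y" "N i a * N j b \<noteq> N i b * N j a"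
proof -
  have "(\<Sum>i\<in>X. gram N Y i i)\<^sup>2 =
      (\<Sum>i\<in>X. \<Sum>j\<in>X. \<Sum>a\<in>Y. \<Sum>b\<in>Y. (N i a * N j b) * (N i a * N j b))"
    by (simp add: power2_eq_square sum_product gram_def mult_ac)
  moreover have "(\<Sum>i\<in>X. \<Sum>j\<in>X. gram N Y i j * gram N Y j i) =
      (\<Sum>i\<in>X. \<Sum>j\<in>X. \<Sum>a\<in>Y. \<Sum>b\<in>Y. (N i a * N j b) * (N i b * N j a))"
    by (simp add: sum_product gram_def mult_ac)
  ultimately have "\<not> (\<forall>i\<in>X. \<forall>j\<in>X. \<forall>a\<in>Y. \<forall>b\<in>Y. N i a * N j b = N i b * N j a)"
    using assms by (metis (mono_tags, lifting) sum.cong)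
  then show ?thesis
    using that by blast
qed

section \<open>Walk counts and two-colourings of bipartite graphs\<close>

text \<open>Splitting off the first step as well as the last is what allows a closed walk to be
  rotated in \<open>closed_walks_Suc\<close>.\<close>

lemma walks_Suc_left:
  assumes "finite V" "u \<in> V" "v \<in> V"
  shows "walks V E (Suc k) u v = (\<Sum>w\<in>V. of_bool (E u w) * walks V E k w v)"
  using assms(3)
proof (induction k arbitrary: v)
  case 0
  have "(\<Sum>w\<in>V. of_bool (u = w) * of_bool (E w v)) = (\<Sum>w\<in>V. if w = u then of_bool (E u v) else (0 :: nat))"
    by (intro sum.cong) auto
  moreover have "(\<Sum>w\<in>V. of_bool (E u w) * of_bool (w = v)) = (\<Sum>w\<in>V. if w = v then of_bool (E u v) else (0 :: nat))"
    by (intro sum.cong) auto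
  ultimately show ?case
    using assms 0 by simp
next
  case (Suc k)
  have "walks V E (Suc (Suc k)) u v =
      (\<Sum>x\<in>V. \<Sum>w\<in>V. of_bool (E u w) * walks V E k w x * of_bool (E x v))"
    by (subst walks.simps(2)) (simp add: Suc.IH sum_distrib_right del: walks.simps(2))
  also have "\<dots> = (\<Sum>w\<in>V. of_bool (E u w) * (\<Sum>x\<in>V. walks V E k w x * of_bool (E x v)))"
    by (subst sum.swap) (simp add: sum_distrib_left mult.assoc)
  finally show ?case
    by simp
qed

lemma walks_add:
  assumes "finite V" "v \<in> V"
  shows "walks V E (k + l) u v = (\<Sum>w\<in>V. walks V E k u w * walks V E l w v)"
  using assms(2)
proof (induction l arbitrary: v)
  case 0
  have "(\<Sum>w\<in>V. walks V E k u w * of_bool (w = v)) = (\<Sum>w\<in>V. if w = v then walks V E k u v else 0)"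
    by (intro sum.cong) auto
  then show ?case
    using assms(1) 0 by simp
next
  case (Suc l)
  have "walks V E (k + Suc l) u v =
      (\<Sum>x\<in>V. \<Sum>w\<in>V. walks V E k u w * walks V E l w x * of_bool (E x v))"
    by (simp add: Suc.IH sum_distrib_right)
  also have "\<dots> = (\<Sum>w\<in>V. walks V E k u w * walks V E (Suc l) w v)"
    by (subst sum.swap) (simp add: sum_distrib_left mult.assoc)
  finally show ?case .
qed

locale bipartition =
  fixes X Y :: "'a set" and E :: "'a \<Rightarrow> 'a \<Rightarrow> bool"
  assumes finite_X: "finite X" and finite_Y: "finite Y" and disjoint: "X \<inter> Y = {}"
    and E_sym: "E u v \<Longrightarrow> E v u"
    and no_edge_X: "\<lbrakk>u \<in> X; v \<in> X\<rbrakk> \<Longrightarrow> \<not> E u v"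
    and no_edge_Y: "\<lbrakk>u \<in> Y; v \<in> Y\<rbrakk> \<Longrightarrow> \<not> E u v"
begin

lemma swap: "bipartition Y X E"
  by unfold_locales
    (use finite_X finite_Y disjoint E_sym no_edge_X no_edge_Y in auto)

text \<open>On X times Y this is the biadjacency matrix, and on Y times X its transpose. Thus
  \<open>gram N Y\<close> on X is N N^T, and \<open>gram N X\<close> on Y is N^T N.\<close>

abbreviation N :: "'a \<Rightarrow> 'a \<Rightarrow> int" where
  "N u v \<equiv> of_bool (E u v)"

lemma walks_parity:
  assumes "u \<in> X \<union> Y" "v \<in> X \<union> Y" "walks (X \<union> Y) E k u v \<noteq> 0"
  shows "even k \<longleftrightarrow> (u \<in> X \<longleftrightarrow> v \<in> X)"
  using assms(2,3)
proof (induction k arbitrary: v)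
  case 0
  then show ?case
    by (simp split: if_splits)
next
  case (Suc k)
  from Suc.prems(2) have "(\<Sum>w\<in>X \<union> Y. walks (X \<union> Y) E k u w * of_bool (E w v)) \<noteq> 0"
    by simp
  then obtain w where w: "w \<in> X \<union> Y" "walks (X \<union> Y) E k u w \<noteq> 0" "E w v"
    by (elim sum.not_neutral_contains_not_neutral) (simp split: if_splits)
  then have "w \<in> X \<longleftrightarrow> v \<notin> X"
    using Suc.prems(1) no_edge_X no_edge_Y by blast
  then show ?case
    using Suc.IH[OF w(1,2)] by simp
qed

lemma closed_walks_odd: "odd k \<Longrightarrow> closed_walks (X \<union> Y) E k = 0"
  unfolding closed_walks_def using walks_parity by (intro sum.neutral) blast

text \<open>Moving the first step to the end matches closed walks based in X with those based in Y.
  Length 0 is excluded because there is no step to move.\<close>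

lemma closed_walks_Suc:
  "closed_walks (X \<union> Y) E (Suc k) = 2 * (\<Sum>x\<in>X. walks (X \<union> Y) E (Suc k) x x)"
proof -
  let ?V = "X \<union> Y"
  have fin: "finite ?V"
    using finite_X finite_Y by simp
  have "(\<Sum>x\<in>X. walks ?V E (Suc k) x x) = (\<Sum>x\<in>X. \<Sum>y\<in>Y. of_bool (E x y) * walks ?V E k y x)"
    by (intro sum.cong refl)
      (auto simp: walks_Suc_left[OF fin] sum.union_disjoint[OF finite_X finite_Y disjoint]
        no_edge_X simp del: walks.simps)
  also have "\<dots> = (\<Sum>y\<in>Y. \<Sum>x\<in>X. walks ?V E k y x * of_bool (E x y))"
    by (subst sum.swap) (simp add: mult.commute)
  also have "\<dots> = (\<Sum>y\<in>Y. walks ?V E (Suc k) y y)"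
    by (intro sum.cong refl)
      (auto simp: sum.union_disjoint[OF finite_X finite_Y disjoint] no_edge_Y)
  finally show ?thesis
    by (simp add: closed_walks_def sum.union_disjoint[OF finite_X finite_Y disjoint] del: walks.simps)
qed

text \<open>A walk of length 2 between vertices of X passes through a common neighbour in Y. The
  factor \<open>of_bool (v \<in> X)\<close> extends the formula to all of X \<union> Y, where the
  intermediate vertex of \<open>walks_add\<close> ranges.\<close>

lemma walks_2:
  assumes "x \<in> X" "v \<in> X \<union> Y"
  shows "int (walks (X \<union> Y) E 2 x v) = of_bool (v \<in> X) * gram N Y x v"
proof (cases "v \<in> X")
  case True
  have "walks (X \<union> Y) E (Suc (Suc 0)) x v =
      (\<Sum>w\<in>X \<union> Y. of_bool (E x w) * (\<Sum>u\<in>X \<union> Y. of_bool (w = u) * of_bool (E u v)))"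
    using assms finite_X finite_Y by (subst walks_Suc_left) auto
  also have "\<dots> = (\<Sum>w\<in>X \<union> Y. of_bool (E x w) * of_bool (E w v))"
  proof (intro sum.cong refl)
    fix w
    assume "w \<in> X \<union> Y"
    moreover have "(\<Sum>u\<in>X \<union> Y. of_bool (w = u) * of_bool (E u v)) =
        (\<Sum>u\<in>X \<union> Y. if u = w then of_bool (E w v) else (0 :: nat))"
      by (intro sum.cong) auto
    ultimately show "of_bool (E x w) * (\<Sum>u\<in>X \<union> Y. of_bool (w = u) * of_bool (E u v)) =
        (of_bool (E x w) * of_bool (E w v) :: nat)"
      using finite_X finite_Y by simp
  qed
  also have "\<dots> = (\<Sum>w\<in>Y. of_bool (E x w) * of_bool (E w v))"
    using assms(1) no_edge_X by (simp add: sum.union_disjoint[OF finite_X finite_Y disjoint])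
  also have "int \<dots> = gram N Y x v"
    unfolding gram_def by (auto intro!: sum.cong dest: E_sym)
  finally show ?thesis
    using True by (simp add: numeral_2_eq_2)
next
  case False
  then show ?thesis
    using walks_parity[of x v 2] assms by auto
qed

lemma walks_add_2:
  assumes "x \<in> X" "v \<in> X"
  shows "int (walks (X \<union> Y) E (2 + k) x v) = (\<Sum>w\<in>X. gram N Y x w * int (walks (X \<union> Y) E k w v))"
proof -
  have "int (walks (X \<union> Y) E (2 + k) x v) =
      (\<Sum>w\<in>X \<union> Y. of_bool (w \<in> X) * gram N Y x w * int (walks (X \<union> Y) E k w v))"
    using assms finite_X finite_Y by (subst walks_add) (simp_all add: walks_2)
  then show ?thesis
    using disjoint by (auto simp: sum.union_disjoint[OF finite_X finite_Y disjoint] intro!: sum.neutral)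
qed

text \<open>Two steps starting in X act on X as N N^T, so the walks of length 2m based in X have
  count trace((N N^T)^m); those based in Y double it.\<close>

lemma traces:
  shows "int (closed_walks (X \<union> Y) E 2) = 2 * (\<Sum>i\<in>X. gram N Y i i)"
    and "int (closed_walks (X \<union> Y) E 4) = 2 * (\<Sum>i\<in>X. \<Sum>j\<in>X. gram N Y i j * gram N Y j i)"
    and "int (closed_walks (X \<union> Y) E 6) =
      2 * (\<Sum>i\<in>X. \<Sum>j\<in>X. \<Sum>k\<in>X. gram N Y i j * gram N Y j k * gram N Y k i)"
proof -
  have even: "int (closed_walks (X \<union> Y) E k) = 2 * (\<Sum>x\<in>X. int (walks (X \<union> Y) E k x x))" if "k > 0" for k
    using closed_walks_Suc[of "k - 1"] that by simp
  have w4: "int (walks (X \<union> Y) E 4 x v) = (\<Sum>w\<in>X. gram N Y x w * gram N Y w v)"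
    if "x \<in> X" "v \<in> X" for x v
    using walks_add_2[of x v 2] that by (simp add: walks_2)
  show "int (closed_walks (X \<union> Y) E 2) = 2 * (\<Sum>i\<in>X. gram N Y i i)"
    by (simp add: even walks_2)
  show "int (closed_walks (X \<union> Y) E 4) = 2 * (\<Sum>i\<in>X. \<Sum>j\<in>X. gram N Y i j * gram N Y j i)"
    by (simp add: even w4)
  have "int (walks (X \<union> Y) E 6 x x) =
      (\<Sum>j\<in>X. \<Sum>k\<in>X. gram N Y x j * gram N Y j k * gram N Y k x)" if "x \<in> X" for x
    using walks_add_2[of x x 4] that by (simp add: w4 sum_distrib_left mult.assoc)
  then show "int (closed_walks (X \<union> Y) E 6) =
      2 * (\<Sum>i\<in>X. \<Sum>j\<in>X. \<Sum>k\<in>X. gram N Y i j * gram N Y j k * gram N Y k i)"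
    by (simp add: even)
qed

end

text \<open>A graph without odd closed walks is 2-coloured by the parity of the walks that
  start at a fixed representative of each component.\<close>
lemma bipartition_exists:
  fixes E :: "'a \<Rightarrow> 'a \<Rightarrow> bool"
  assumes fin: "finite V" and sym: "\<And>u v. E u v \<Longrightarrow> E v u"
    and E_V: "\<And>u v. E u v \<Longrightarrow> u \<in> V \<and> v \<in> V"
    and odd: "\<And>k. odd k \<Longrightarrow> closed_walks V E k = 0"
  obtains X Y where "bipartition X Y E" "V = X \<union> Y"
proof -
  \<comment> \<open>Relation powers compose and reverse easily; all they need from
    \<open>walks\<close> is that its value is nonzero.\<close>
  have pos: "v \<in> V \<and> walks V E k u v \<noteq> 0" if "(E ^^ k) u v" "u \<in> V" for k u v
    using that
  proof (induction k arbitrary: v)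
    case (Suc k)
    from Suc.prems(1) obtain w where w: "(E ^^ k) u w" "E w v"
      by auto
    then have "w \<in> V" "v \<in> V" "walks V E k u w * of_bool (E w v) \<noteq> 0"
      using Suc.IH Suc.prems(2) E_V by auto
    moreover from this(1) have "walks V E k u w * of_bool (E w v) \<le> walks V E (Suc k) u v"
      using fin by (auto intro!: member_le_sum)
    ultimately show ?case
      by linarith
  qed auto
  have no_odd: "\<not> (E ^^ k) u u" if "odd k" "u \<in> V" for k u
    using odd[OF that(1)] that pos[of k u u] fin by (auto simp: closed_walks_def)
  have rev: "(E ^^ k) v u" if "(E ^^ k) u v" for k u v
    using that
  proof (induction k arbitrary: v)
    case (Suc k)
    then show ?case
      by (metis relpowp_Suc_I2 relpowp_Suc_E sym)
  qed auto
  \<comment> \<open>Adjacent vertices have the same reachability predicate, so the choice operator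
    picks the same representative for both.\<close>
  define r where "r u = (SOME w. E\<^sup>*\<^sup>* u w)" for u
  have r: "E\<^sup>*\<^sup>* u (r u)" for u
    unfolding r_def by (rule someI[of _ u]) simp
  have symp: "E\<^sup>*\<^sup>* v u" if "E\<^sup>*\<^sup>* u v" for u v
    using that rev by (metis rtranclp_imp_relpowp relpowp_imp_rtranclp)
  have r_eq: "r u = r v" if "E u v" for u v
  proof -
    have "E\<^sup>*\<^sup>* u = E\<^sup>*\<^sup>* v"
      using that sym by (intro ext) (meson converse_rtranclp_into_rtranclp)
    then show ?thesis
      by (simp add: r_def)
  qed
  have r_V: "r u \<in> V" if "u \<in> V" for u
    using r[of u] that pos by (metis rtranclp_imp_relpowp)
  define c where "c u \<longleftrightarrow> (\<exists>k. even k \<and> (E ^^ k) (r u) u)" for u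
  have c: "c u \<noteq> c v" if uv: "E u v" for u v
  proof
    assume eq: "c u = c v"
    obtain k l where k: "(E ^^ k) (r u) u" and l: "(E ^^ l) (r u) v" and kl: "even k \<longleftrightarrow> even l"
    proof (cases "c u")
      case True
      then show ?thesis
        using that eq r_eq[OF uv] unfolding c_def by metis
    next
      \<comment> \<open>No walk from the representative to \<open>u\<close> or to \<open>v\<close>
        has even length, so arbitrary lengths \<open>k\<close> and \<open>l\<close> are both
        odd.\<close>
      case False
      obtain k l where "(E ^^ k) (r u) u" "(E ^^ l) (r v) v"
        using r symp by (metis rtranclp_imp_relpowp)
      then show ?thesis
        using that False eq r_eq[OF uv] unfolding c_def by metis
    qed
    \<comment> \<open>Out to \<open>u\<close>, across the edge, and back from \<open>v\<close>: a
      closed walk of odd length \<open>k + 1 + l\<close>.\<close>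
    have "(E ^^ (Suc k + l)) (r u) (r u)"
      using k uv rev[OF l] by (metis relpowp_Suc_I relpowp_trans)
    moreover have "r u \<in> V"
      using r_V E_V[OF uv] by blast
    ultimately show False
      using no_odd kl by (metis even_Suc even_add)
  qed
  show ?thesis
  proof (rule that)
    show "bipartition {v \<in> V. c v} {v \<in> V. \<not> c v} E"
      by unfold_locales (use fin sym c in auto)
    show "V = {v \<in> V. c v} \<union> {v \<in> V. \<not> c v}"
      by blast
  qed
qed

section \<open>From the traces to a blow-up of P_4\<close>

text \<open>The counts \<open>p\<close>, \<open>q\<close>, \<open>r\<close> are the numbers of rows with patterns 10, 01, 11 in a 0/1 matrix
  whose columns fall into two classes of sizes \<open>u\<close> and \<open>v\<close>. If no pattern is missing, the blow-up of
  a 5-vertex path has too few edges; without \<open>r\<close> there would be two components.\<close>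
lemma class_sizes:
  fixes u v p q r n :: nat
  assumes "u > 0" "v > 0" "n > 0"
    and edges: "u * (p + r) + v * (q + r) = n + 2"
    and minors: "u * v * (p * q + p * r + q * r) = n"
  shows "r > 0 \<and> (p > 0 \<and> q = 0 \<or> p = 0 \<and> q > 0)"
proof -
  have "\<not> (p > 0 \<and> q > 0)" if "r = 0"
  proof
    assume "p > 0 \<and> q > 0"
    then obtain a b where "u * p = Suc a" "v * q = Suc b"
      using assms(1,2) by (metis gr0_implies_Suc nat_0_less_mult_iff)
    moreover have "n = (u * p) * (v * q)" "n + 2 = u * p + v * q"
      using edges minors that by (simp_all add: mult_ac)
    \<comment> \<open>Now \<open>Suc a * Suc b + 2 = Suc a + Suc b\<close>, which amounts to
      \<open>a * b = -1\<close>.\<close>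
    ultimately show False
      by simp
  qed
  moreover have "\<not> (p > 0 \<and> q > 0)" if r: "r > 0"
  proof
    assume "p > 0 \<and> q > 0"
    then obtain a b c d e where "u = Suc a" "v = Suc b" "p = Suc c" "q = Suc d" "r = Suc e"
      using r assms(1,2) by (auto simp: gr0_conv_Suc)
    \<comment> \<open>After the shift by 1 every nonconstant monomial on the left is dominated by
      its counterpart on the right. The constants are 4 < 3 + 2, the case of P_5 itself.\<close>
    then have "u * (p + r) + v * (q + r) < u * v * (p * q + p * r + q * r) + 2"
      by (simp add: algebra_simps)
    then show False
      unfolding edges minors by simp
  qed
  moreover have "p * q + p * r + q * r \<noteq> 0"
    using minors assms(3) by auto
  ultimately show ?thesis
    by (cases "r = 0") auto
qed

text \<open>Classes \<open>A\<close>, \<open>C\<close> on one side and \<open>B\<close>, \<open>D\<close> on the other form a blow-up of a 4-vertex path.\<close>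
definition p4_blowup :: "('a \<Rightarrow> 'a \<Rightarrow> bool) \<Rightarrow> 'a set \<Rightarrow> 'a set \<Rightarrow> bool" where
  "p4_blowup E X Y \<longleftrightarrow> (\<exists>A B C D. A \<noteq> {} \<and> B \<noteq> {} \<and> C \<noteq> {} \<and> D \<noteq> {} \<and> A \<inter> C = {} \<and> B \<inter> D = {} \<and>
     A \<union> C = {x \<in> X. \<exists>y\<in>Y. E x y} \<and> B \<union> D = {y \<in> Y. \<exists>x\<in>X. E x y} \<and>
     (\<forall>a\<in>A. \<forall>b\<in>B. E a b) \<and> (\<forall>c\<in>C. \<forall>b\<in>B. E c b) \<and> (\<forall>c\<in>C. \<forall>d\<in>D. E c d))"

context bipartition
begin

lemma gram_eq_card: "gram N X y y' = int (card {x \<in> X. E x y \<and> E x y'})"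
proof -
  have "gram N X y y' = (\<Sum>x\<in>X. of_bool (E x y \<and> E x y'))"
    unfolding gram_def by (intro sum.cong) (auto dest: E_sym)
  then show ?thesis
    using finite_X by (simp add: Int_def)
qed

text \<open>Each vertex of X is described by its pattern \<open>(s x, t x)\<close>. The traces then
  express e1 and e2 through the sizes of U, V and the three nonzero pattern classes, and
  \<open>class_sizes\<close> leaves the path P-U-R-V or Q-V-R-U.\<close>

lemma p4_blowup_if_two_classes:
  assumes "n > 0"
    and t1: "(\<Sum>y\<in>Y. gram N X y y) = int n + 2"
    and t2: "(\<Sum>y\<in>Y. \<Sum>y'\<in>Y. gram N X y y' * gram N X y' y) = (int n + 2)\<^sup>2 - 2 * int n"
    and U: "U \<subseteq> Y" "U \<noteq> {}" and V: "V \<subseteq> Y" "V \<noteq> {}" and UV: "U \<inter> V = {}"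
    and s: "\<And>x y. x \<in> X \<Longrightarrow> y \<in> U \<Longrightarrow> E x y \<longleftrightarrow> s x"
    and t: "\<And>x y. x \<in> X \<Longrightarrow> y \<in> V \<Longrightarrow> E x y \<longleftrightarrow> t x"
    and rest: "\<And>x y. x \<in> X \<Longrightarrow> y \<in> Y \<Longrightarrow> E x y \<Longrightarrow> y \<in> U \<union> V"
  shows "p4_blowup E X Y"
proof -
  define P where "P = {x \<in> X. s x \<and> \<not> t x}"
  define Q where "Q = {x \<in> X. \<not> s x \<and> t x}"
  define R where "R = {x \<in> X. s x \<and> t x}"
  define u v p q r where defs: "u = card U" "v = card V" "p = card P" "q = card Q" "r = card R"
  have fin: "finite P" "finite Q" "finite R" "finite U" "finite V"
    using finite_X finite_Y U V finite_subset by (auto simp: P_def Q_def R_def)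
  have uv: "u > 0" "v > 0"
    using U V fin by (simp_all add: defs card_gt_0_iff)
  have gUU: "gram N X y y' = int (p + r)" if "y \<in> U" "y' \<in> U" for y y'
  proof -
    have "{x \<in> X. E x y \<and> E x y'} = P \<union> R"
      using s that by (auto simp: P_def R_def)
    moreover have "P \<inter> R = {}"
      by (auto simp: P_def R_def)
    ultimately show ?thesis
      using fin by (simp add: gram_eq_card card_Un_disjoint defs)
  qed
  have gVV: "gram N X y y' = int (q + r)" if "y \<in> V" "y' \<in> V" for y y'
  proof -
    have "{x \<in> X. E x y \<and> E x y'} = Q \<union> R"
      using t that by (auto simp: Q_def R_def)
    moreover have "Q \<inter> R = {}"
      by (auto simp: Q_def R_def)
    ultimately show ?thesis
      using fin by (simp add: gram_eq_card card_Un_disjoint defs)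
  qed
  have gUV: "gram N X y y' = int r" "gram N X y' y = int r" if "y \<in> U" "y' \<in> V" for y y'
  proof -
    have "{x \<in> X. E x y \<and> E x y'} = R" "{x \<in> X. E x y' \<and> E x y} = R"
      using s t that by (auto simp: R_def)
    then show "gram N X y y' = int r" "gram N X y' y = int r"
      by (simp_all add: gram_eq_card defs)
  qed
  have g0: "gram N X y y' = 0" "gram N X y' y = 0" if "y \<in> Y" "y \<notin> U \<union> V" for y y'
  proof -
    have "{x \<in> X. E x y \<and> E x y'} = {}" "{x \<in> X. E x y' \<and> E x y} = {}"
      using rest that by auto
    then show "gram N X y y' = 0" "gram N X y' y = 0"
      by (simp_all only: gram_eq_card card.empty of_nat_0)
  qed
  have split: "(\<Sum>y\<in>Y. f y) = (\<Sum>y\<in>U. f y) + (\<Sum>y\<in>V. f y)"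
    if "\<And>y. y \<in> Y \<Longrightarrow> y \<notin> U \<union> V \<Longrightarrow> f y = 0" for f :: "'a \<Rightarrow> int"
  proof -
    have "sum f Y = sum f (U \<union> V)"
      using that U(1) V(1) finite_Y by (intro sum.mono_neutral_right) auto
    then show ?thesis
      using fin UV by (simp add: sum.union_disjoint)
  qed
  have e: "int u * int (p + r) + int v * int (q + r) = int n + 2"
    using t1 by (subst (asm) split) (simp_all add: g0 gUU gVV defs)
  have row: "(\<Sum>y'\<in>Y. gram N X y y' * gram N X y' y) =
      (\<Sum>y'\<in>U. gram N X y y' * gram N X y' y) + (\<Sum>y'\<in>V. gram N X y y' * gram N X y' y)" for y
    by (rule split) (simp add: g0)
  have "(int n + 2)\<^sup>2 - 2 * int n = int u * (int u * (int (p + r))\<^sup>2 + int v * (int r)\<^sup>2)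
      + int v * (int u * (int r)\<^sup>2 + int v * (int (q + r))\<^sup>2)"
    unfolding t2[symmetric] row
    by (subst split) (simp_all add: g0 gUU gVV gUV defs power2_eq_square)
  \<comment> \<open>Substituting \<open>e\<close> for \<open>int n + 2\<close> leaves e1^2 - t2 = 2
    e2. A 2x2 minor is nonzero, namely 1 or -1, exactly for one column from each of U and V and two
    rows of different nonzero patterns.\<close>
  then have "2 * int n = 2 * int (u * v * (p * q + p * r + q * r))"
    unfolding e[symmetric] by (simp add: power2_eq_square algebra_simps)
  then have "u * v * (p * q + p * r + q * r) = n"
    by linarith
  moreover have "u * (p + r) + v * (q + r) = n + 2"
    using e by (simp flip: of_nat_mult of_nat_add)
  ultimately have pqr: "r > 0 \<and> (p > 0 \<and> q = 0 \<or> p = 0 \<and> q > 0)"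
    using class_sizes[OF uv assms(1)] by blast
  have nz: "p > 0 \<longleftrightarrow> P \<noteq> {}" "q > 0 \<longleftrightarrow> Q \<noteq> {}" "r > 0 \<longleftrightarrow> R \<noteq> {}"
    "p = 0 \<longleftrightarrow> P = {}" "q = 0 \<longleftrightarrow> Q = {}"
    using fin by (auto simp: defs card_gt_0_iff)
  have nbr: "(\<exists>y\<in>Y. E x y) \<longleftrightarrow> s x \<or> t x" if "x \<in> X" for x
  proof
    assume "\<exists>y\<in>Y. E x y"
    then obtain y where "y \<in> Y" "E x y"
      by blast
    then show "s x \<or> t x"
      using rest[OF that] s[OF that] t[OF that] by auto
  next
    obtain a b where "a \<in> U" "b \<in> V"
      using U V by blast
    moreover assume "s x \<or> t x"
    ultimately show "\<exists>y\<in>Y. E x y"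
      using s[OF that] t[OF that] U(1) V(1) by blast
  qed
  have X1: "P \<union> Q \<union> R = {x \<in> X. \<exists>y\<in>Y. E x y}"
    by (auto simp: P_def Q_def R_def nbr cong: conj_cong)
  have edges: "\<forall>x\<in>P. \<forall>y\<in>U. E x y" "\<forall>x\<in>R. \<forall>y\<in>U. E x y" "\<forall>x\<in>Q. \<forall>y\<in>V. E x y" "\<forall>x\<in>R. \<forall>y\<in>V. E x y"
    using s t by (auto simp: P_def Q_def R_def)
  \<comment> \<open>A vertex of R is adjacent to all of U and V, so none of these is
    isolated.\<close>
  obtain x where x: "x \<in> R" "x \<in> X"
    using pqr nz by (auto simp: R_def)
  have Y1: "U \<union> V = {y \<in> Y. \<exists>x\<in>X. E x y}"
  proof
    show "U \<union> V \<subseteq> {y \<in> Y. \<exists>x\<in>X. E x y}"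
      using x edges(2,4) U(1) V(1) by blast
    show "{y \<in> Y. \<exists>x\<in>X. E x y} \<subseteq> U \<union> V"
      using rest by blast
  qed
  have disj: "P \<inter> R = {}" "Q \<inter> R = {}"
    by (auto simp: P_def Q_def R_def)
  from pqr show ?thesis
  proof (elim conjE disjE)
    assume "r > 0" "p > 0" "q = 0"
    then have "P \<noteq> {}" "R \<noteq> {}" "P \<union> R = {x \<in> X. \<exists>y\<in>Y. E x y}"
      using nz X1 by simp_all
    then show ?thesis
      unfolding p4_blowup_def using U(2) V(2) UV Y1 edges disj
      by (intro exI[of _ P] exI[of _ U] exI[of _ R] exI[of _ V] conjI)
  next
    assume "r > 0" "p = 0" "q > 0"
    then have "Q \<noteq> {}" "R \<noteq> {}" "Q \<union> R = {x \<in> X. \<exists>y\<in>Y. E x y}"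
      using nz X1 by simp_all
    moreover have "V \<inter> U = {}" "V \<union> U = {y \<in> Y. \<exists>x\<in>X. E x y}"
      using UV Y1 by auto
    ultimately show ?thesis
      unfolding p4_blowup_def using U(2) V(2) edges disj
      by (intro exI[of _ Q] exI[of _ V] exI[of _ R] exI[of _ U] conjI)
  qed
qed

text \<open>A nonzero 2x2 minor in rows \<open>i\<close>, \<open>j\<close> and the vanishing of all
  3x3 minors make a column depend only on its entries in rows \<open>i\<close> and \<open>j\<close>.
  If one of the patterns 10, 01, 11 is missing, Y has two classes; otherwise X has.\<close>

lemma p4_blowup_if_traces:
  assumes "n > 0"
    and t1: "closed_walks (X \<union> Y) E 2 = 2 * (n + 2)"
    and t2: "int (closed_walks (X \<union> Y) E 4) = 2 * ((int n + 2)\<^sup>2 - 2 * int n)"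
    and t3: "int (closed_walks (X \<union> Y) E 6) = 2 * ((int n + 2) ^ 3 - 3 * int n * (int n + 2))"
  shows "p4_blowup E X Y \<or> p4_blowup E Y X"
proof -
  interpret sw: bipartition Y X E
    by (rule swap)
  have "int (closed_walks (X \<union> Y) E 2) = 2 * (int n + 2)"
    by (simp add: t1)
  then have g1: "(\<Sum>i\<in>X. gram N Y i i) = int n + 2" "(\<Sum>i\<in>Y. gram N X i i) = int n + 2"
    using traces(1) sw.traces(1) by (simp_all add: Un_commute)
  have g2: "(\<Sum>i\<in>X. \<Sum>j\<in>X. gram N Y i j * gram N Y j i) = (int n + 2)\<^sup>2 - 2 * int n"
    "(\<Sum>i\<in>Y. \<Sum>j\<in>Y. gram N X i j * gram N X j i) = (int n + 2)\<^sup>2 - 2 * int n"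
    using traces(2) sw.traces(2) t2 by (simp_all add: Un_commute)
  have g3: "(\<Sum>i\<in>X. \<Sum>j\<in>X. \<Sum>k\<in>X. gram N Y i j * gram N Y j k * gram N Y k i) =
      (int n + 2) ^ 3 - 3 * int n * (int n + 2)"
    using traces(3) t3 by simp
  have det3: "det3 N i j k a b c = 0" if "i \<in> X" "j \<in> X" "k \<in> X" "a \<in> Y" "b \<in> Y" "c \<in> Y" for i j k a b c
    by (rule det3_eq_0[OF finite_X finite_Y g1(1) g2(1) g3 _ that])
      (simp add: power2_eq_square power3_eq_cube algebra_simps)
  obtain i j a b where ij: "i \<in> X" "j \<in> X" and ab: "a \<in> Y" "b \<in> Y"
    and minor: "N i a * N j b \<noteq> N i b * N j a"
  proof (rule exists_nonzero_minor2)
    show "(\<Sum>i\<in>X. gram N Y i i)\<^sup>2 \<noteq> (\<Sum>i\<in>X. \<Sum>j\<in>X. gram N Y i j * gram N Y j i)"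
      unfolding g1 g2 using \<open>n > 0\<close> by simp
  qed (rule that)
  \<comment> \<open>The determinant is linear in its last column, and the difference of the columns
    \<open>c\<close> and \<open>c'\<close> is zero in rows \<open>i\<close> and \<open>j\<close>.
    Only the entry in row \<open>k\<close> times the chosen minor remains.\<close>
  have row: "E k c \<longleftrightarrow> E k c'"
    if "k \<in> X" "c \<in> Y" "c' \<in> Y" "E i c \<longleftrightarrow> E i c'" "E j c \<longleftrightarrow> E j c'" for k c c'
  proof -
    have "(N k c - N k c') * (N i a * N j b - N i b * N j a) = det3 N i j k a b c - det3 N i j k a b c'"
      unfolding det3_def that(4,5) by (simp add: algebra_simps)
    then have "N k c = N k c'"
      using det3[OF ij that(1) ab that(2)] det3[OF ij that(1) ab that(3)] minor by simp
    then show ?thesis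
      by (simp add: of_bool_eq_iff)
  qed
  have row0: "\<not> E k c" if "k \<in> X" "c \<in> Y" "\<not> E i c" "\<not> E j c" for k c
  proof -
    have "N k c * (N i a * N j b - N i b * N j a) = det3 N i j k a b c"
      using that(3,4) by (simp add: det3_def algebra_simps)
    then have "N k c = 0"
      using det3[OF ij that(1) ab that(2)] minor by simp
    then show ?thesis
      by simp
  qed
  define P where "P = {y \<in> Y. E i y \<and> \<not> E j y}"
  define Q where "Q = {y \<in> Y. \<not> E i y \<and> E j y}"
  define T where "T = {y \<in> Y. E i y \<and> E j y}"
  have two: "p4_blowup E X Y"
    if UV: "U = P \<and> V = Q \<and> T = {} \<or> U = P \<and> V = T \<and> Q = {} \<or> U = Q \<and> V = T \<and> P = {}"
      and ne: "U \<noteq> {}" "V \<noteq> {}" for U V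
  proof -
    obtain u v where uv: "u \<in> U" "v \<in> V"
      using ne by blast
    show ?thesis
    proof (rule p4_blowup_if_two_classes[OF \<open>n > 0\<close> g1(2) g2(2)])
      show "U \<subseteq> Y" "V \<subseteq> Y" "U \<inter> V = {}"
        using UV by (auto simp: P_def Q_def T_def)
      show "U \<noteq> {}" "V \<noteq> {}"
        by fact+
      show "E x y \<longleftrightarrow> E x u" if "x \<in> X" "y \<in> U" for x y
        using UV uv that by - (rule row, auto simp: P_def Q_def T_def)
      show "E x y \<longleftrightarrow> E x v" if "x \<in> X" "y \<in> V" for x y
        using UV uv that by - (rule row, auto simp: P_def Q_def T_def)
      show "y \<in> U \<union> V" if "x \<in> X" "y \<in> Y" "E x y" for x y
        using UV row0[of x y] that by (auto simp: P_def Q_def T_def)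
    qed
  qed
  \<comment> \<open>The columns \<open>a\<close> and \<open>b\<close> are independent in rows
    \<open>i\<close>, \<open>j\<close>, so their patterns are nonzero and different.\<close>
  have "P \<noteq> {} \<and> Q \<noteq> {} \<or> P \<noteq> {} \<and> T \<noteq> {} \<or> Q \<noteq> {} \<and> T \<noteq> {}"
  proof -
    have "x \<in> P \<longleftrightarrow> E i x \<and> \<not> E j x" "x \<in> Q \<longleftrightarrow> \<not> E i x \<and> E j x" "x \<in> T \<longleftrightarrow> E i x \<and> E j x"
      if "x \<in> {a, b}" for x
      using that ab by (auto simp: P_def Q_def T_def)
    moreover have "E i a \<and> E j b \<and> \<not> (E i b \<and> E j a) \<or> \<not> (E i a \<and> E j b) \<and> E i b \<and> E j a"
      using minor by (auto simp flip: of_bool_conj)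
    ultimately show ?thesis
      by blast
  qed
  then consider "P \<noteq> {}" "Q \<noteq> {}" "T = {}" | "P \<noteq> {}" "T \<noteq> {}" "Q = {}" | "Q \<noteq> {}" "T \<noteq> {}" "P = {}"
    | "P \<noteq> {}" "Q \<noteq> {}" "T \<noteq> {}"
    by blast
  then show ?thesis
  proof cases
    case 4
    then obtain x y z where x: "x \<in> P" and y: "y \<in> Q" and z: "z \<in> T"
      by blast
    have xyz: "x \<in> Y" "y \<in> Y" "z \<in> Y"
      using x y z by (auto simp: P_def Q_def T_def)
    \<comment> \<open>In columns \<open>x\<close>, \<open>y\<close>, \<open>z\<close> the rows
      \<open>i\<close> and \<open>j\<close> read 101 and 011, so the vanishing minor says
      \<open>N k z = N k x + N k y\<close>; with 0/1 entries the sum cannot be 2.\<close>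
    have excl: "\<not> (E k x \<and> E k y)" and kz: "E k z \<longleftrightarrow> E k x \<or> E k y" if "k \<in> X" for k
      using det3[OF ij that xyz] x y z
      by (auto simp: det3_def P_def Q_def T_def of_bool_def split: if_splits)
    \<comment> \<open>Row \<open>k\<close> equals row \<open>i\<close> if it meets \<open>x\<close>,
      row \<open>j\<close> if it meets \<open>y\<close>, and is zero otherwise. These are the two
      classes on the X side.\<close>
    have types: "E k w \<longleftrightarrow> E i w \<and> E k x \<or> E j w \<and> E k y" if "k \<in> X" "w \<in> Y" for k w
    proof (cases "E i w"; cases "E j w")
      assume "E i w" "E j w"
      then show ?thesis
        using row[OF that xyz(3)] kz[OF that(1)] z by (auto simp: T_def)
    next
      assume "E i w" "\<not> E j w"
      then show ?thesis
        using row[OF that xyz(1)] x by (auto simp: P_def)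
    next
      assume "\<not> E i w" "E j w"
      then show ?thesis
        using row[OF that xyz(2)] y by (auto simp: Q_def)
    next
      assume "\<not> E i w" "\<not> E j w"
      then show ?thesis
        using row0[OF that] by simp
    qed
    have comm: "E u v \<longleftrightarrow> E v u" for u v
      using E_sym by blast
    have "p4_blowup E Y X"
    proof (rule sw.p4_blowup_if_two_classes[OF \<open>n > 0\<close> g1(1) g2(1)])
      show "{k \<in> X. E k x} \<subseteq> X" "{k \<in> X. E k y} \<subseteq> X" "{k \<in> X. E k x} \<inter> {k \<in> X. E k y} = {}"
        using excl by auto
      show "{k \<in> X. E k x} \<noteq> {}" "{k \<in> X. E k y} \<noteq> {}"
        using x y ij by (auto simp: P_def Q_def)
      show "E w k \<longleftrightarrow> E i w" if "w \<in> Y" "k \<in> {k \<in> X. E k x}" for w k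
        using that types[of k w] excl[of k] comm[of w k] by auto
      show "E w k \<longleftrightarrow> E j w" if "w \<in> Y" "k \<in> {k \<in> X. E k y}" for w k
        using that types[of k w] excl[of k] comm[of w k] by auto
      show "k \<in> {k \<in> X. E k x} \<union> {k \<in> X. E k y}" if "w \<in> Y" "k \<in> X" "E w k" for w k
        using that types[of k w] comm[of w k] by auto
    qed
    then show ?thesis ..
  qed (use two in blast)+
qed

end

section \<open>Closed walks of the double star\<close>

lemma double_star_edges:
  "(u, v) \<in> parcs (double_star 1 n) \<longleftrightarrow>
    (u, v) \<in> {(Inl 0, Inl 1), (Inl 1, Inl 0), (Inl 0, Inr 0), (Inr 0, Inl 0)} \<or>
    (\<exists>k\<in>{1..n}. (u, v) = (Inr 0, Inr k) \<or> (u, v) = (Inr k, Inr 0))"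
proof -
  have "map_prod Inr Inr ` ({0} \<times> {1..n} \<union> {1..n} \<times> {0}) =
      (\<Union>k\<in>{1..n}. {(Inr 0, Inr k), (Inr k, Inr 0)} :: ((nat + nat) \<times> (nat + nat)) set)"
    by (auto simp: map_prod_def)
  then show ?thesis
    unfolding double_star_def star_graph_def by auto
qed

text \<open>The values are Newton's formulas e1, e1^2 - 2 e2 and e1^3 - 3 e1 e2 for e1 = n + 2, e2 =
  n, e3 = 0, doubled for the two colour classes.\<close>

lemma closed_walks_double_star:
  fixes n :: nat
  defines "V \<equiv> pverts (double_star 1 n)" and "E \<equiv> \<lambda>u v. (u, v) \<in> parcs (double_star 1 n)"
  shows "odd k \<Longrightarrow> closed_walks V E k = 0"
    and "closed_walks V E 2 = 2 * (n + 2)"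
    and "int (closed_walks V E 4) = 2 * ((int n + 2)\<^sup>2 - 2 * int n)"
    and "int (closed_walks V E 6) = 2 * ((int n + 2) ^ 3 - 3 * int n * (int n + 2))"
proof -
  \<comment> \<open>The colour class with two vertices, the centre of the large star and the leaf of
    the small one. Its Gram matrix has rows (n + 1, 1) and (1, 1), hence trace n + 2 and determinant
    n.\<close>
  define X :: "(nat + nat) set" where "X = {Inr 0, Inl 1}"
  define Y :: "(nat + nat) set" where "Y = insert (Inl 0) (Inr ` {1..n})"
  have E: "E u v \<longleftrightarrow> (u, v) \<in> {(Inl 0, Inl 1), (Inl 1, Inl 0), (Inl 0, Inr 0), (Inr 0, Inl 0)} \<or>
      (\<exists>k\<in>{1..n}. (u, v) = (Inr 0, Inr k) \<or> (u, v) = (Inr k, Inr 0))" for u v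
    unfolding E_def by (rule double_star_edges)
  interpret bipartition X Y E
    by unfold_locales (auto simp: X_def Y_def E)
  have V: "V = X \<union> Y"
    by (auto simp: V_def X_def Y_def double_star_def star_graph_def atLeast0_atMost_Suc)
  interpret sw: bipartition Y X E
    by (rule swap)
  have "{y \<in> Y. E y (Inr 0) \<and> E y (Inr 0)} = Y"
    "{y \<in> Y. E y (Inr 0) \<and> E y (Inl 1)} = {Inl 0}"
    "{y \<in> Y. E y (Inl 1) \<and> E y (Inr 0)} = {Inl 0}"
    "{y \<in> Y. E y (Inl 1) \<and> E y (Inl 1)} = {Inl 0}"
    by (auto simp: Y_def E)
  moreover have "card Y = n + 1"
    unfolding Y_def by (subst card_insert_disjoint) (auto simp: card_image)
  ultimately have g: "gram N Y (Inr 0) (Inr 0) = int n + 1" "gram N Y (Inr 0) (Inl 1) = 1"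
    "gram N Y (Inl 1) (Inr 0) = 1" "gram N Y (Inl 1) (Inl 1) = 1"
    unfolding sw.gram_eq_card by (simp_all del: One_nat_def)
  show "odd k \<Longrightarrow> closed_walks V E k = 0"
    unfolding V by (rule closed_walks_odd)
  have "int (closed_walks V E 2) = int (2 * (n + 2))"
    unfolding V traces by (simp add: X_def g del: One_nat_def)
  then show "closed_walks V E 2 = 2 * (n + 2)"
    by (simp only: of_nat_eq_iff)
  show "int (closed_walks V E 4) = 2 * ((int n + 2)\<^sup>2 - 2 * int n)"
    unfolding V traces by (simp add: X_def g power2_eq_square algebra_simps del: One_nat_def)
  show "int (closed_walks V E 6) = 2 * ((int n + 2) ^ 3 - 3 * int n * (int n + 2))"
    unfolding V traces by (simp add: X_def g power2_eq_square power3_eq_cube algebra_simps del: One_nat_def)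
qed

section \<open>The partition of the non-isolated vertices\<close>

lemma complete_bipartite_parts_induced:
  assumes G: "graph G" and fin: "finite A" "finite B" and ne: "A \<noteq> {}" "B \<noteq> {}"
    and sub: "A \<union> B \<subseteq> verts G"
    and AB: "\<And>a b. a \<in> A \<Longrightarrow> b \<in> B \<Longrightarrow> a \<rightarrow>\<^bsub>G\<^esub> b"
    and A: "\<And>a a'. a \<in> A \<Longrightarrow> a' \<in> A \<Longrightarrow> \<not> a \<rightarrow>\<^bsub>G\<^esub> a'"
    and B: "\<And>b b'. b \<in> B \<Longrightarrow> b' \<in> B \<Longrightarrow> \<not> b \<rightarrow>\<^bsub>G\<^esub> b'"
  shows "complete_bipartite_parts A B (G \<restriction> (A \<union> B))"
proof -
  interpret graph G
    by (rule G)
  have ind: "induced_subgraph (G \<restriction> (A \<union> B)) G"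
    using sub by (rule induced_induce)
  have "graph (G \<restriction> (A \<union> B))"
    using digraphI_induced[OF ind] induced_graph_imp_graph[OF ind]
    by (simp add: graph_def pseudo_graph_def digraph_def)
  moreover have "(u, v) \<in> arcs_ends (G \<restriction> (A \<union> B)) \<longleftrightarrow> u \<rightarrow>\<^bsub>G\<^esub> v \<and> u \<in> A \<union> B \<and> v \<in> A \<union> B" for u v
    by (auto simp: arcs_ends_conv)
  then have "arcs_ends (G \<restriction> (A \<union> B)) = A \<times> B \<union> B \<times> A"
    using AB A B graph_symmetric by auto
  moreover have "A \<inter> B = {}"
    using AB A by blast
  ultimately show ?thesis
    using ne by (simp add: complete_bipartite_parts_def)
qed

lemma partition_if_p4_blowup:
  fixes G :: "('a, 'b) pre_digraph"
  assumes G: "graph G" and bip: "bipartition X Y (\<lambda>u v. u \<rightarrow>\<^bsub>G\<^esub> v)" and V: "verts G = X \<union> Y"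
    and p4: "p4_blowup (\<lambda>u v. u \<rightarrow>\<^bsub>G\<^esub> v) X Y"
  shows "\<exists>A B C D. distinct [A, B, C, D] \<and> partition_on (non_isolated G) {A, B, C, D} \<and>
    complete_bipartite_parts A B (G \<restriction> (A \<union> B)) \<and>
    complete_bipartite_parts B C (G \<restriction> (B \<union> C)) \<and>
    complete_bipartite_parts C D (G \<restriction> (C \<union> D))"
proof -
  interpret graph G
    by (rule G)
  interpret bipartition X Y "\<lambda>u v. u \<rightarrow>\<^bsub>G\<^esub> v"
    by (rule bip)
  obtain A B C D where ne: "A \<noteq> {}" "B \<noteq> {}" "C \<noteq> {}" "D \<noteq> {}"
    and disj: "A \<inter> C = {}" "B \<inter> D = {}"
    and AC: "A \<union> C = {x \<in> X. \<exists>y\<in>Y. x \<rightarrow>\<^bsub>G\<^esub> y}" and BD: "B \<union> D = {y \<in> Y. \<exists>x\<in>X. x \<rightarrow>\<^bsub>G\<^esub> y}"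
    and edges: "\<forall>a\<in>A. \<forall>b\<in>B. a \<rightarrow>\<^bsub>G\<^esub> b" "\<forall>c\<in>C. \<forall>b\<in>B. c \<rightarrow>\<^bsub>G\<^esub> b" "\<forall>c\<in>C. \<forall>d\<in>D. c \<rightarrow>\<^bsub>G\<^esub> d"
    using p4 unfolding p4_blowup_def by (elim exE conjE) (rule that)
  have sub: "A \<subseteq> X" "C \<subseteq> X" "B \<subseteq> Y" "D \<subseteq> Y"
    using AC BD by blast+
  have fin: "finite A" "finite B" "finite C" "finite D"
    using sub finite_X finite_Y finite_subset by blast+
  have XY: "A \<inter> B = {}" "A \<inter> D = {}" "B \<inter> C = {}" "C \<inter> D = {}"
    using sub disjoint by blast+
  have nbr: "(\<exists>w\<in>X \<union> Y. u \<rightarrow>\<^bsub>G\<^esub> w) \<longleftrightarrow> (\<exists>w\<in>Y. u \<rightarrow>\<^bsub>G\<^esub> w)" if "u \<in> X" for u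
    using no_edge_X[OF that] by blast
  have nbr': "(\<exists>w\<in>X \<union> Y. u \<rightarrow>\<^bsub>G\<^esub> w) \<longleftrightarrow> (\<exists>w\<in>X. w \<rightarrow>\<^bsub>G\<^esub> u)" if "u \<in> Y" for u
    using no_edge_Y[OF that] graph_symmetric by blast
  have ni: "non_isolated G = A \<union> C \<union> (B \<union> D)"
    unfolding AC BD non_isolated_def V using nbr nbr' by blast
  have part: "partition_on (non_isolated G) {A, B, C, D}"
  proof (intro partition_onI)
    show "\<Union> {A, B, C, D} = non_isolated G"
      using ni by auto
    show "{} \<notin> {A, B, C, D}"
      using ne by simp
    show "disjnt p q" if "p \<in> {A, B, C, D}" "q \<in> {A, B, C, D}" "p \<noteq> q" for p q
      using that disj XY by (elim insertE emptyE) (simp_all add: disjnt_def Int_commute)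
  qed
  have indep: "\<not> u \<rightarrow>\<^bsub>G\<^esub> v" if "u \<in> A \<union> C \<and> v \<in> A \<union> C \<or> u \<in> B \<union> D \<and> v \<in> B \<union> D" for u v
    using that sub no_edge_X[of u v] no_edge_Y[of u v] by auto
  have verts: "A \<union> B \<subseteq> verts G" "B \<union> C \<subseteq> verts G" "C \<union> D \<subseteq> verts G"
    using sub V by auto
  have BC: "b \<rightarrow>\<^bsub>G\<^esub> c" if "b \<in> B" "c \<in> C" for b c
    using that edges(2) E_sym by simp
  have "complete_bipartite_parts A B (G \<restriction> (A \<union> B))"
    by (rule complete_bipartite_parts_induced[OF G fin(1,2) ne(1,2) verts(1)])
      (use edges(1) indep in simp_all)
  moreover have "complete_bipartite_parts B C (G \<restriction> (B \<union> C))"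
    by (rule complete_bipartite_parts_induced[OF G fin(2,3) ne(2,3) verts(2)])
      (use BC indep in simp_all)
  moreover have "complete_bipartite_parts C D (G \<restriction> (C \<union> D))"
    by (rule complete_bipartite_parts_induced[OF G fin(3,4) ne(3,4) verts(3)])
      (use edges(3) indep in simp_all)
  \<comment> \<open>The set \<open>{A, B, C, D}\<close> would silently collapse if two classes
    coincided; nonempty disjoint classes cannot.\<close>
  moreover have "distinct [A, B, C, D]"
    using ne disj XY by auto
  ultimately show ?thesis
    using part by blast
qed

theorem theorem3p6:
  fixes G :: "('a, 'b) pre_digraph" and n :: nat
  assumes "n \<ge> 3"
    and "graph G"
    and "cospectral G (with_proj (double_star 1 n))"
  shows "\<exists>A B C D. distinct [A, B, C, D] \<and> partition_on (non_isolated G) {A, B, C, D} \<and>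
    complete_bipartite_parts A B (G \<restriction> (A \<union> B)) \<and>
    complete_bipartite_parts B C (G \<restriction> (B \<union> C)) \<and>
    complete_bipartite_parts C D (G \<restriction> (C \<union> D))"
proof -
  interpret graph G
    by (rule assms(2))
  let ?E = "\<lambda>u v. u \<rightarrow>\<^bsub>G\<^esub> v"
  have "finite (pverts (double_star 1 n))"
    by (simp add: double_star_def star_graph_def)
  then have cw: "closed_walks (verts G) ?E k =
      closed_walks (pverts (double_star 1 n)) (\<lambda>u v. (u, v) \<in> parcs (double_star 1 n)) k" for k
    using cospectral_closed_walks_eq[OF assms(3), of k] by simp
  obtain X Y where bip: "bipartition X Y ?E" and V: "verts G = X \<union> Y"
  proof (rule bipartition_exists[of "verts G" ?E])
    show "u \<rightarrow>\<^bsub>G\<^esub> v \<Longrightarrow> v \<rightarrow>\<^bsub>G\<^esub> u" for u v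
      by (rule graph_symmetric)
    show "odd k \<Longrightarrow> closed_walks (verts G) ?E k = 0" for k
      unfolding cw by (rule closed_walks_double_star(1))
  qed (auto intro: that)
  have "p4_blowup ?E X Y \<or> p4_blowup ?E Y X"
    using bip assms(1) cw[unfolded V] closed_walks_double_star(2-4)[of n]
    by (intro bipartition.p4_blowup_if_traces[where n = n]) simp_all
  \<comment> \<open>The conclusion does not mention the colouring, so either orientation of the
    blow-up yields it.\<close>
  then show ?thesis
    using partition_if_p4_blowup[OF assms(2) bip V]
      partition_if_p4_blowup[OF assms(2) bipartition.swap[OF bip] V[unfolded Un_commute[of X]]]
    by blast
qed

end
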